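(* Let $q$ be an odd prime power, $d\ge2$, $Q$ a nondegenerate quadratic form on $\mathbb F_q^d$, $P\subseteq\mathbb F_q^d$ nonempty and $\mathcal S$ a nonempty family of distinct $Q$-spheres. Put $\mu=1-\frac{I(P,\mathcal S)}{|P||\mathcal S|}$, assume $0\le\mu<\frac{d+1}{(d+2)^2}$, and put $\delta=\sqrt{(d+1)\mu}$. Suppose that for some $\gamma>\delta$, $$|P\cap V|\le(1-\gamma)|P|$$ for every affine flat $V\subseteq\mathbb F_q^d$ of codimension two. Then there exist an affine subspace $L\subseteq\mathbb F_q^{d+1}$ and subsets $P_0\subseteq P\cap B(L)$, $\mathcal S_0\subseteq\mathcal S\cap\mathcal S(L)$ with $$|P_0|\ge(1-\delta)|P|,\qquad|\mathcal S_0|\ge(1-\delta)|\mathcal S|,$$ and every such classifying space $L$ has dimension at most one. If moreover $(1-\delta)|\mathcal S|\ge2$, then $\dim L=1$: after deleting at most a $\delta$-fraction from each side, the remaining spheres lie in one coaxal pencil $\mathcal S(L)$ and the remaining points lie in its common sphere-pair section $B(L)=S\cap S'$ ($S\ne S'$ any two members of the pencil).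
   Context: Put $\langle x,y\rangle_Q=\frac{Q(x+y)-Q(x)-Q(y)}2$. For $c\in\mathbb F_q^d$, $r\in\mathbb F_q$ the $Q$-sphere is $S_Q(c,r)=\{x\in\mathbb F_q^d:Q(x-c)=r\}$; spheres are parametrized by pairs $(c,r)$ and distinct spheres means distinct parameter pairs. $I(P,\mathcal S)=|\{(p,S)\in P\times\mathcal S:p\in S\}|$. The lift is $\Phi(S_Q(c,r))=(2c,r-Q(c))\in\mathbb F_q^{d+1}$. For $x\in\mathbb F_q^d$, $y=(u,a)\in\mathbb F_q^d\times\mathbb F_q$ put $\Lambda_x(y)=Q(x)-\langle x,u\rangle_Q-a$. For a (nonempty) affine subspace $L\subseteq\mathbb F_q^{d+1}$ put $\mathcal S(L)=\Phi^{-1}(L)$ and $B(L)=\{x\in\mathbb F_q^d:\Lambda_x(y)=0\ \forall y\in L\}$. A coaxal pencil is the $q$-member family of spheres whose lifts form an affine line in $\mathbb F_q^{d+1}$ (the line through the lifts of two distinct spheres $S_0,S_1$); any two distinct members have the same intersection $S_0\cap S_1$. *)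

theory Defs
  imports "HOL-Analysis.Analysis"
begin

section \<open>Affine subspaces of a vector space over an arbitrary field\<close>

text \<open>
  The library's \<open>affine\<close> and \<open>aff_dim\<close> are confined to real vector spaces. The scalar
  multiplication is passed explicitly, as in \<open>vector_space\<close>.
\<close>

definition flat :: "('a::field \<Rightarrow> 'b::ab_group_add \<Rightarrow> 'b) \<Rightarrow> 'b set \<Rightarrow> bool" where
  "flat s L \<longleftrightarrow> (\<exists>p W. module.subspace s W \<and> L = (\<lambda>w. p + w) ` W)"

definition flat_direction :: "'b::ab_group_add set \<Rightarrow> 'b set" where
  "flat_direction L = {x - y | x y. x \<in> L \<and> y \<in> L}"

definition flat_dim :: "('a::field \<Rightarrow> 'b::ab_group_add \<Rightarrow> 'b) \<Rightarrow> 'b set \<Rightarrow> nat" where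
  "flat_dim s L = vector_space.dim s (flat_direction L)"

definition line_through :: "('a::field \<Rightarrow> 'b::ab_group_add \<Rightarrow> 'b) \<Rightarrow> 'b \<Rightarrow> 'b \<Rightarrow> 'b set" where
  "line_through s a b = range (\<lambda>t. a + s t (b - a))"

text \<open>
  The \<open>(d+1)\<close>-dimensional space is modelled as the product of the \<open>d\<close>-dimensional
  one with the field; its scalar multiplication is \<open>lifted.scale\<close>.
\<close>

interpretation lifted: finite_dimensional_vector_space_prod
  "(*s) :: 'a::field \<Rightarrow> 'a ^ 'n \<Rightarrow> 'a ^ 'n" "(*) :: 'a \<Rightarrow> 'a \<Rightarrow> 'a" cart_basis "{1}"
  by unfold_locales


section \<open>Quadratic forms\<close>

definition polar :: "('a::field ^ 'n \<Rightarrow> 'a) \<Rightarrow> 'a ^ 'n \<Rightarrow> 'a ^ 'n \<Rightarrow> 'a" where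
  "polar Q x y = (Q (x + y) - Q x - Q y) / 2"

text \<open>
  The factor \<open>1/2\<close> in \<open>polar\<close> makes the next two definitions appropriate only when
  the characteristic is not two.
\<close>

definition quadratic_form :: "('a::field ^ 'n \<Rightarrow> 'a) \<Rightarrow> bool" where
  "quadratic_form Q \<longleftrightarrow>
     (\<forall>c x. Q (c *s x) = c\<^sup>2 * Q x) \<and>
     (\<forall>y. Vector_Spaces.linear (*s) (*) (\<lambda>x. polar Q x y)) \<and>
     (\<forall>x. Vector_Spaces.linear (*s) (*) (polar Q x))"

definition nondegenerate :: "('a::field ^ 'n \<Rightarrow> 'a) \<Rightarrow> bool" where
  "nondegenerate Q \<longleftrightarrow> (\<forall>x. (\<forall>y. polar Q x y = 0) \<longrightarrow> x = 0)"


section \<open>Spheres and their lifts\<close>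

text \<open>
  A sphere is a parameter pair \<open>(c, r)\<close>, so that different pairs count as different
  spheres; \<open>sphere_points\<close> is its point set.
\<close>

type_synonym ('a, 'n) qsphere = "('a ^ 'n) \<times> 'a"

fun sphere_points :: "('a::field ^ 'n \<Rightarrow> 'a) \<Rightarrow> ('a, 'n) qsphere \<Rightarrow> ('a ^ 'n) set" where
  "sphere_points Q (c, r) = {x. Q (x - c) = r}"

definition incidences ::
  "('a::field ^ 'n \<Rightarrow> 'a) \<Rightarrow> ('a ^ 'n) set \<Rightarrow> ('a, 'n) qsphere set \<Rightarrow> nat" where
  "incidences Q P \<S> = card {(p, S). p \<in> P \<and> S \<in> \<S> \<and> p \<in> sphere_points Q S}"

fun sphere_lift :: "('a::field ^ 'n \<Rightarrow> 'a) \<Rightarrow> ('a, 'n) qsphere \<Rightarrow> ('a ^ 'n) \<times> 'a" where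
  "sphere_lift Q (c, r) = (2 *s c, r - Q c)"

fun incidence_functional :: "('a::field ^ 'n \<Rightarrow> 'a) \<Rightarrow> 'a ^ 'n \<Rightarrow> ('a ^ 'n) \<times> 'a \<Rightarrow> 'a" where
  "incidence_functional Q x (u, a) = Q x - polar Q x u - a"

definition spheres_of :: "('a::field ^ 'n \<Rightarrow> 'a) \<Rightarrow> (('a ^ 'n) \<times> 'a) set \<Rightarrow> ('a, 'n) qsphere set" where
  "spheres_of Q L = sphere_lift Q -` L"

definition base_points :: "('a::field ^ 'n \<Rightarrow> 'a) \<Rightarrow> (('a ^ 'n) \<times> 'a) set \<Rightarrow> ('a ^ 'n) set" where
  "base_points Q L = {x. \<forall>y\<in>L. incidence_functional Q x y = 0}"

text \<open>
  In odd characteristic \<open>sphere_lift Q\<close> is a bijection, so the family is determined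
  by the line and has as many members as the field has elements.
\<close>

definition coaxal_pencil :: "('a::field ^ 'n \<Rightarrow> 'a) \<Rightarrow> ('a, 'n) qsphere set \<Rightarrow> bool" where
  "coaxal_pencil Q F \<longleftrightarrow>
     (\<exists>S0 S1. S0 \<noteq> S1 \<and>
        sphere_lift Q ` F = line_through lifted.scale (sphere_lift Q S0) (sphere_lift Q S1))"

definition classifies ::
  "('a::field ^ 'n \<Rightarrow> 'a) \<Rightarrow> ('a ^ 'n) set \<Rightarrow> ('a, 'n) qsphere set \<Rightarrow> real \<Rightarrow>
   (('a ^ 'n) \<times> 'a) set \<Rightarrow> ('a ^ 'n) set \<Rightarrow> ('a, 'n) qsphere set \<Rightarrow> bool" where
  "classifies Q P \<S> \<delta> L P0 \<S>0 \<longleftrightarrow>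
     flat lifted.scale L \<and>
     P0 \<subseteq> P \<inter> base_points Q L \<and> \<S>0 \<subseteq> \<S> \<inter> spheres_of Q L \<and>
     real (card P0) \<ge> (1 - \<delta>) * real (card P) \<and>
     real (card \<S>0) \<ge> (1 - \<delta>) * real (card \<S>)"

end

theory Submission
  imports Defs
begin

text \<open>
  Incidence of \<open>x\<close> with a sphere says that the affine functional \<open>\<Lambda>\<^sub>x\<close> vanishes at the lift of
  the sphere. By Markov's inequality all but a \<open>\<delta>\<close>-fraction of the spheres miss at most
  \<open>\<delta>|P|/(d+1)\<close> points each. The lifts of these good spheres span a flat \<open>L\<close>, which is already
  spanned by \<open>dim L + 1\<close> of them, so at most \<open>(dim L + 1)\<delta>|P|/(d+1)\<close> points lie outside
  \<open>B(L)\<close>. If \<open>L\<close> were the whole space, then \<open>B(L) = {}\<close> and hence \<open>\<delta> \<ge> (d+1)/(d+2)\<close>, which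
  the bound on \<open>\<mu>\<close> excludes; so \<open>dim L \<le> d\<close> and at most \<open>\<delta>|P|\<close> points are lost. Conversely,
  if \<open>dim L \<ge> 2\<close> and \<open>B(L)\<close> is nonempty, two independent directions of \<open>L\<close> confine \<open>B(L)\<close> to
  a flat of codimension two, contradicting the non-concentration hypothesis.
\<close>

section \<open>Flats in finite-dimensional spaces\<close>

context finite_dimensional_vector_space
begin

text \<open>Every \<open>x\<close> in \<open>W\<close> differs from \<open>(f x / f e) * e\<close>
  by an element of the kernel, so the kernel together with the single vector \<open>e\<close> spans
  \<open>W\<close>. Applied twice, this gives the codimension count for two orthogonality
  conditions.\<close>

lemma dim_kernel_functional:
  assumes "Vector_Spaces.linear scale (*) f" "subspace W" "e \<in> W" "f e \<noteq> 0"
  shows "dim W = Suc (dim {x \<in> W. f x = 0})"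
proof -
  interpret f: Vector_Spaces.linear scale "(*)" f by fact
  let ?K = "{x \<in> W. f x = 0}"
  have K: "subspace ?K"
    using assms(2) by (auto simp: subspace_def f.add f.scale f.zero)
  have "e \<notin> span ?K"
    unfolding span_eq_iff[THEN iffD2, OF K] using assms(4) by simp
  then have "dim (insert e ?K) = Suc (dim ?K)"
    by (simp add: dim_insert)
  moreover have "span (insert e ?K) = W"
  proof
    show "span (insert e ?K) \<subseteq> W"
      by (rule span_minimal) (use assms in auto)
    show "W \<subseteq> span (insert e ?K)"
    proof
      fix x assume x: "x \<in> W"
      let ?c = "f x / f e"
      have "x - scale ?c e \<in> W"
        using x assms by (simp add: subspace_diff subspace_scale)
      moreover have "f (x - scale ?c e) = 0"
        using assms(4) by (simp add: f.diff f.scale)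
      ultimately have "x - scale ?c e \<in> span ?K"
        by (simp add: span_base)
      then show "x \<in> span (insert e ?K)"
        by (auto simp: span_insert)
    qed
  qed
  ultimately show ?thesis
    by (metis dim_span)
qed

lemma flat_direction_translate:
  assumes "subspace W"
  shows "flat_direction ((\<lambda>w. p + w) ` W) = W"
proof
  show "flat_direction ((\<lambda>w. p + w) ` W) \<subseteq> W"
    using assms by (auto simp: flat_direction_def subspace_diff)
  show "W \<subseteq> flat_direction ((\<lambda>w. p + w) ` W)"
  proof
    fix w assume "w \<in> W"
    then have "w = (p + w) - (p + 0)" "p + w \<in> (\<lambda>w. p + w) ` W" "p + 0 \<in> (\<lambda>w. p + w) ` W"
      using subspace_0[OF assms] by (auto simp del: add_0_right)
    then show "w \<in> flat_direction ((\<lambda>w. p + w) ` W)"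
      unfolding flat_direction_def by blast
  qed
qed

lemma flat_cases:
  assumes "flat scale L"
  obtains p W where "subspace W" "L = (\<lambda>w. p + w) ` W" "flat_direction L = W"
    "flat_dim scale L = dim W"
  using assms that flat_direction_translate by (auto simp: flat_def flat_dim_def)

text \<open>Any point of a flat can serve as its base point: moving the base point from
  \<open>p0\<close> to \<open>p0 + w0\<close> only shifts vectors of the direction space by
  \<open>w0\<close>, which lies in it.\<close>

lemma flat_eq_translate:
  assumes "flat scale L" "p \<in> L"
  shows "L = (\<lambda>w. p + w) ` flat_direction L" "subspace (flat_direction L)"
proof -
  obtain p0 W where W: "subspace W" "L = (\<lambda>w. p0 + w) ` W" "flat_direction L = W"
    using assms(1) by (rule flat_cases)
  obtain w0 where w0: "w0 \<in> W" "p = p0 + w0"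
    using W assms(2) by auto
  have "p0 + w \<in> (\<lambda>w. p + w) ` W" if "w \<in> W" for w
    by (rule image_eqI[of _ _ "w - w0"]) (use that W w0 in \<open>auto intro: subspace_diff\<close>)
  moreover have "p + w \<in> L" if "w \<in> W" for w
    using that W w0 by (auto simp: add.assoc intro!: imageI subspace_add)
  ultimately show "L = (\<lambda>w. p + w) ` flat_direction L"
    using W by auto
  show "subspace (flat_direction L)"
    using W by simp
qed

lemma dim_gt_1_independent_pair:
  assumes "dim W > 1"
  obtains v w where "v \<in> W" "w \<in> W" "v \<noteq> 0" "w \<notin> span {v}"
proof -
  have "\<not> W \<subseteq> {0}"
    using assms by (metis dim_eq_0 not_one_less_zero)
  then obtain v where v: "v \<in> W" "v \<noteq> 0" by auto
  have "\<not> W \<subseteq> span {v}"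
    using assms dim_le_card[of W "{v}"] by auto
  then show ?thesis using v that by auto
qed

text \<open>The span of \<open>b - a\<close> is a one-dimensional subspace of a direction space of
  dimension at most one, hence all of it. This later turns the dimension bound into a coaxal
  pencil.\<close>

lemma flat_dim_le_1_eq_line:
  assumes "flat scale L" "flat_dim scale L \<le> 1" "a \<in> L" "b \<in> L" "a \<noteq> b"
  shows "L = line_through scale a b" "flat_dim scale L = 1"
proof -
  let ?W = "flat_direction L"
  have W: "subspace ?W" "L = (\<lambda>w. a + w) ` ?W"
    using flat_eq_translate assms by auto
  have "b - a \<in> ?W"
    using assms by (auto simp: flat_direction_def)
  then have sub: "span {b - a} \<subseteq> ?W"
    using W(1) by (simp add: span_minimal)
  have one: "dim (span {b - a}) = 1"
    using assms by simp
  then have "?W = span {b - a}"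
    using subspace_dim_equal[of "span {b - a}" ?W] W(1) sub assms(2)
    by (simp add: flat_dim_def)
  then show "L = line_through scale a b" "flat_dim scale L = 1"
    using W(2) one by (auto simp: flat_dim_def line_through_def span_singleton)
qed

text \<open>\<open>B\<close> is a maximal independent set of differences \<open>a - p\<close>. The
  point is that the affine generators \<open>p\<close> and \<open>p + b\<close> belong to
  \<open>A\<close> itself, so any property of the members of \<open>A\<close> holds for
  them.\<close>

lemma flat_hull:
  assumes "A \<noteq> {}"
  obtains p B where "p \<in> A" "independent B" "(\<lambda>b. p + b) ` B \<subseteq> A"
    "A \<subseteq> (\<lambda>w. p + w) ` span B"
proof -
  obtain p where p: "p \<in> A" using assms by auto
  let ?D = "(\<lambda>a. a - p) ` A"
  obtain B where B: "B \<subseteq> ?D" "independent B" "?D \<subseteq> span B"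
    using maximal_independent_subset by blast
  have "(\<lambda>b. p + b) ` B \<subseteq> A"
    using B(1) by auto
  moreover have "A \<subseteq> (\<lambda>w. p + w) ` span B"
  proof
    fix a assume "a \<in> A"
    then have "a - p \<in> span B" "a = p + (a - p)"
      using B(3) by auto
    then show "a \<in> (\<lambda>w. p + w) ` span B" by blast
  qed
  ultimately show ?thesis using that p B(2) by blast
qed

end

section \<open>Quadratic forms in odd characteristic\<close>

text \<open>Translation by 1 permutes the field, so the sum of all elements is unchanged when 1 is
  added to each; hence the cardinality is zero in the field. If 2 were zero as well, an odd
  cardinality would give 1 = 0.\<close>

lemma two_neq_zero_if_odd_card:
  assumes "odd CARD('a::{field, finite})"
  shows "(2::'a) \<noteq> 0"
proof
  assume 2: "(2::'a) = 0"
  obtain k where k: "CARD('a) = 2 * k + 1"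
    using assms by (rule oddE)
  have "(\<Sum>x\<in>UNIV. x + 1) = (\<Sum>x\<in>UNIV. x::'a)"
    by (rule sum.reindex_bij_witness[of _ "\<lambda>x. x - 1" "\<lambda>x. x + 1"]) auto
  then have "of_nat CARD('a) = (0::'a)"
    by (simp add: sum.distrib)
  then show False
    using k 2 by simp
qed

lemma polar_commute: "polar Q x y = polar Q y x"
  by (simp add: polar_def add.commute algebra_simps)

locale odd_quadratic_form =
  fixes Q :: "'a::{field, finite} ^ 'n \<Rightarrow> 'a"
  assumes quadratic: "quadratic_form Q" and two [simp]: "(2::'a) \<noteq> 0"
begin

lemma linear_polar: "Vector_Spaces.linear (*s) (*) (\<lambda>x. polar Q x y)"
  using quadratic by (simp add: quadratic_form_def)

lemma linear_polar_right: "Vector_Spaces.linear (*s) (*) (polar Q x)"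
  using quadratic by (simp add: quadratic_form_def)

sublocale polar: Vector_Spaces.linear "(*s)" "(*)" "polar Q x" for x
  by (rule linear_polar_right)

lemma Q_diff: "Q (x - c) = Q x - 2 * polar Q x c + Q c"
proof -
  have "polar Q x (- c) = - polar Q x c"
    by (rule polar.neg)
  moreover have "Q (- c) = Q c"
    using quadratic unfolding quadratic_form_def
    by (metis mult_1 power2_minus power_one vec.scale_minus_left vec.scale_one)
  moreover have "2 * polar Q x (- c) = Q (x - c) - Q x - Q (- c)"
    by (simp add: polar_def)
  ultimately show ?thesis by (simp add: algebra_simps)
qed

text \<open>The part of the incidence functional that depends on the lift, up to sign. It is linear
  in \<open>y\<close>, whereas the functional is only affine, so incidence becomes the equation
  \<open>\<phi> x y = Q x\<close>.\<close>

definition \<phi> :: "'a ^ 'n \<Rightarrow> ('a ^ 'n) \<times> 'a \<Rightarrow> 'a" where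
  "\<phi> x y = polar Q x (fst y) + snd y"

lemma linear_\<phi>: "Vector_Spaces.linear lifted.scale (*) (\<phi> x)"
  by unfold_locales
    (auto simp: \<phi>_def lifted.scale_def polar.add polar.scale algebra_simps)

sublocale \<phi>: Vector_Spaces.linear lifted.scale "(*)" "\<phi> x" for x
  by (rule linear_\<phi>)

lemma incidence_functional_eq: "incidence_functional Q x y = Q x - \<phi> x y"
  by (cases y) (simp add: \<phi>_def)

lemma mem_base_points: "x \<in> base_points Q L \<longleftrightarrow> (\<forall>y\<in>L. \<phi> x y = Q x)"
  by (auto simp: base_points_def incidence_functional_eq)

text \<open>Expanding \<open>Q (x - c)\<close> leaves \<open>c\<close> only in a term linear in
  \<open>2 *s c\<close> and in the constant \<open>Q c\<close>, which the last coordinate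
  \<open>r - Q c\<close> of the lift absorbs.\<close>

lemma mem_sphere_points: "x \<in> sphere_points Q S \<longleftrightarrow> \<phi> x (sphere_lift Q S) = Q x"
proof (cases S)
  case (Pair c r)
  have "polar Q x (2 *s c) = 2 * polar Q x c"
    by (rule polar.scale)
  then show ?thesis
    by (auto simp: Pair \<phi>_def Q_diff algebra_simps)
qed

lemma bij_sphere_lift: "bij (sphere_lift Q)"
proof (rule bijI)
  show "inj (sphere_lift Q)"
    by (auto simp: inj_def)
  \<comment> \<open>The center is half of the vector part, and adding its \<open>Q\<close>-value to
    the scalar part restores the radius parameter.\<close>
  have "y = sphere_lift Q ((1/2) *s fst y, snd y + Q ((1/2) *s fst y))" for y
    by (cases y) simp
  then show "surj (sphere_lift Q)"
    by (rule surjI[OF sym])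
qed

section \<open>Base points of spanned flats, of the whole space and of lines\<close>

lemma mem_base_points_translate_span:
  assumes "\<phi> x p = Q x" "\<And>b. b \<in> B \<Longrightarrow> \<phi> x (p + b) = Q x"
  shows "x \<in> base_points Q ((\<lambda>w. p + w) ` lifted.p.span B)"
proof -
  have "\<phi> x b = 0" if "b \<in> B" for b
    using assms(1) assms(2)[OF that] by (simp add: \<phi>.add)
  then have "\<phi> x w = 0" if "w \<in> lifted.p.span B" for w
    using \<phi>.eq_0_on_span that by blast
  then show ?thesis
    using assms(1) by (auto simp: mem_base_points \<phi>.add)
qed

lemma base_points_UNIV: "base_points Q UNIV = {}"
proof -
  have "x \<notin> base_points Q UNIV" for x
  proof
    assume "x \<in> base_points Q UNIV"
    then have "\<phi> x (0, 0) = \<phi> x (0, 1)"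
      by (simp add: mem_base_points)
    then show False by (simp add: \<phi>_def)
  qed
  then show ?thesis by blast
qed

text \<open>Along the line \<open>\<phi> x\<close> is an affine function of \<open>t\<close>, so it
  is constantly \<open>Q x\<close> as soon as it takes this value at \<open>t = 0\<close> and
  \<open>t = 1\<close>, that is, at the two lifts.\<close>

lemma base_points_line:
  assumes "L = line_through lifted.scale (sphere_lift Q S) (sphere_lift Q S')"
  shows "base_points Q L = sphere_points Q S \<inter> sphere_points Q S'"
proof -
  let ?a = "sphere_lift Q S" and ?b = "sphere_lift Q S'"
  have "?a + lifted.scale 0 (?b - ?a) \<in> L" "?a + lifted.scale 1 (?b - ?a) \<in> L"
    unfolding assms line_through_def by blast+
  then have "?a \<in> L" "?b \<in> L" by simp_all
  moreover have "\<phi> x (?a + lifted.scale t (?b - ?a)) = \<phi> x ?a + t * (\<phi> x ?b - \<phi> x ?a)" for x t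
    by (simp only: \<phi>.add \<phi>.scale \<phi>.diff)
  ultimately have "x \<in> base_points Q L \<longleftrightarrow> \<phi> x ?a = Q x \<and> \<phi> x ?b = Q x" for x
    unfolding mem_base_points assms line_through_def by fastforce
  then show ?thesis
    unfolding set_eq_iff Int_iff mem_sphere_points by blast
qed

text \<open>Nondegeneracy makes the pairings with \<open>u\<close> and \<open>v\<close> independent
  functionals. The kernel of the first has codimension one, and the second is not identically zero
  on it.\<close>

lemma dim_orthogonal_pair:
  assumes "nondegenerate Q" "u \<noteq> 0" "v \<notin> vec.span {u}"
  shows "vec.dim {x. polar Q x u = 0 \<and> polar Q x v = 0} + 2 = CARD('n)"
proof -
  have exists: "\<exists>x. polar Q x w \<noteq> 0" if "w \<noteq> 0" for w
    using assms(1) that polar_commute[of Q] unfolding nondegenerate_def by metis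
  obtain e where e: "polar Q e u \<noteq> 0"
    using exists assms(2) by blast
  \<comment> \<open>This choice makes \<open>v - ?c *s u\<close> orthogonal to \<open>e\<close>.
    Correcting \<open>x\<close> by a multiple of \<open>e\<close> to make it orthogonal to
    \<open>u\<close> therefore keeps its pairing with \<open>v - ?c *s u\<close>, and for the
    corrected vector this is the pairing with \<open>v\<close>.\<close>
  let ?c = "polar Q e v / polar Q e u"
  have "v - ?c *s u \<noteq> 0"
    using assms(3) vec.span_singleton by (metis eq_iff_diff_eq_0 rangeI)
  then obtain x where x: "polar Q x (v - ?c *s u) \<noteq> 0"
    using exists by blast
  let ?f = "x - (polar Q x u / polar Q e u) *s e"
  interpret l: Vector_Spaces.linear "(*s)" "(*)" "\<lambda>x. polar Q x y" for y
    by (rule linear_polar)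
  have fu: "polar Q ?f u = 0"
    using e by (simp add: l.diff l.scale)
  have fv: "polar Q ?f v \<noteq> 0"
    using x by (simp add: l.diff l.scale polar.diff polar.scale mult.commute)
  let ?U = "{x \<in> UNIV. polar Q x u = 0}"
  have "vec.dim (UNIV :: ('a ^ 'n) set) = Suc (vec.dim ?U)"
    by (rule vec.dim_kernel_functional[of "\<lambda>x. polar Q x u" UNIV e, OF linear_polar])
      (use e in auto)
  moreover have "vec.subspace ?U"
    by (auto simp: vec.subspace_def l.add l.scale l.zero)
  then have "vec.dim ?U = Suc (vec.dim {x \<in> ?U. polar Q x v = 0})"
    by (rule vec.dim_kernel_functional[of "\<lambda>x. polar Q x v" ?U ?f, OF linear_polar])
      (use fu fv in auto)
  ultimately show ?thesis
    by (simp add: card_cart_basis)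
qed

text \<open>At a base point \<open>x0\<close> the map \<open>\<phi> x0\<close> vanishes on the
  directions of \<open>L\<close>, so the scalar part of a direction is determined linearly by its
  vector part. Independent directions thus have independent vector parts, and differences of base
  points are orthogonal to both.\<close>

lemma base_points_in_codim_two_flat:
  assumes "nondegenerate Q" "flat lifted.scale L" "flat_dim lifted.scale L > 1"
    and "base_points Q L \<noteq> {}"
  obtains V where "flat (*s) V" "flat_dim (*s) V + 2 = CARD('n)" "base_points Q L \<subseteq> V"
proof -
  obtain x0 where x0: "x0 \<in> base_points Q L" using assms(4) by auto
  have \<phi>_direction: "\<phi> x w = 0" if x: "x \<in> base_points Q L" and w: "w \<in> flat_direction L" for x w
    proof -
    obtain y z where "w = y - z" "y \<in> L" "z \<in> L"
      using w by (auto simp: flat_direction_def)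
    then show ?thesis
      using x by (simp add: mem_base_points \<phi>.diff)
  qed
  have "lifted.p.dim (flat_direction L) > 1"
    using assms(3) by (simp add: flat_dim_def)
  then obtain v w where vw: "v \<in> flat_direction L" "w \<in> flat_direction L" "v \<noteq> 0"
    "w \<notin> lifted.p.span {v}"
    by (rule lifted.p.dim_gt_1_independent_pair)
  define u where "u = fst v"
  define u' where "u' = fst w"
  have "u \<noteq> 0"
  proof
    assume "u = 0"
    with \<phi>_direction[OF x0 vw(1)] vw(3) show False
      by (cases v) (simp add: \<phi>_def u_def zero_prod_def)
  qed
  moreover have "u' \<notin> vec.span {u}"
  proof
    assume "u' \<in> vec.span {u}"
    then obtain c where c: "u' = c *s u"
      by (auto simp: vec.span_singleton)
    have "\<phi> x0 w = 0" "\<phi> x0 v = 0"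
      using \<phi>_direction x0 vw by auto
    then have "snd w = - polar Q x0 u'" "snd v = - polar Q x0 u"
      by (simp_all add: \<phi>_def u_def u'_def eq_neg_iff_add_eq_0 add.commute)
    then have "snd w = c * snd v"
      using c by (simp add: polar.scale)
    then have "w = lifted.scale c v"
      using c by (simp add: lifted.scale_def u_def u'_def prod_eq_iff)
    then show False
      using vw(4) by (auto simp: lifted.p.span_singleton)
  qed
  ultimately have dim: "vec.dim {x. polar Q x u = 0 \<and> polar Q x u' = 0} + 2 = CARD('n)"
    using dim_orthogonal_pair assms(1) by blast
  let ?W = "{x. polar Q x u = 0 \<and> polar Q x u' = 0}"
  let ?V = "(\<lambda>x. x0 + x) ` ?W"
  interpret l: Vector_Spaces.linear "(*s)" "(*)" "\<lambda>x. polar Q x y" for y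
    by (rule linear_polar)
  have W: "vec.subspace ?W"
    by (auto simp: vec.subspace_def l.add l.scale l.zero)
  have "flat (*s) ?V"
    using W by (auto simp: flat_def)
  moreover have "flat_dim (*s) ?V + 2 = CARD('n)"
    using vec.flat_direction_translate[OF W] dim by (simp add: flat_dim_def)
  moreover have "base_points Q L \<subseteq> ?V"
  proof
    fix x assume x: "x \<in> base_points Q L"
    have "x - x0 \<in> ?W"
      using \<phi>_direction[OF x vw(1)] \<phi>_direction[OF x vw(2)]
        \<phi>_direction[OF x0 vw(1)] \<phi>_direction[OF x0 vw(2)]
      by (simp add: \<phi>_def u_def u'_def l.diff eq_neg_iff_add_eq_0[symmetric])
    then show "x \<in> ?V"
      by (rule rev_image_eqI) simp
  qed
  ultimately show ?thesis by (rule that)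
qed

end

section \<open>Counting incidences\<close>

text \<open>For positive \<open>t\<close>, each counted element contributes more than
  \<open>t\<close> to the sum, and \<open>t\<close> cancels. For \<open>t = 0\<close> the sum is
  zero, so every term vanishes and nothing is counted.\<close>

lemma card_Markov:
  fixes m :: "'b \<Rightarrow> real"
  assumes "finite X" "\<And>x. x \<in> X \<Longrightarrow> 0 \<le> m x" "(\<Sum>x\<in>X. m x) \<le> \<delta> * t * real (card X)"
    and "0 \<le> \<delta>" "0 \<le> t" "\<delta> = 0 \<or> 0 < t"
  shows "real (card {x \<in> X. t < m x}) \<le> \<delta> * real (card X)"
proof (cases "t = 0")
  case True
  then have "(\<Sum>x\<in>X. m x) = 0"
    using assms sum_nonneg[of X m] by simp
  then have "{x \<in> X. t < m x} = {}"
    using assms(1,2) True by (auto simp: sum_nonneg_eq_0_iff)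
  then show ?thesis
    using assms(4) by (simp only: card.empty) simp
next
  case False
  have "real (card {x \<in> X. t < m x}) * t = (\<Sum>x | x \<in> X \<and> t < m x. t)"
    by simp
  also have "\<dots> \<le> (\<Sum>x | x \<in> X \<and> t < m x. m x)"
    by (rule sum_mono) auto
  also have "\<dots> \<le> (\<Sum>x\<in>X. m x)"
    by (rule sum_mono2) (use assms in auto)
  also have "\<dots> \<le> (\<delta> * real (card X)) * t"
    using assms(3) by (simp add: mult_ac)
  finally show ?thesis
    using False assms(5) by simp
qed

text \<open>Double counting: grouping the incidences by sphere, each sphere splits \<open>P\<close>
  into hit and missed points.\<close>

lemma sum_card_missed_points:
  fixes P :: "('a::{field, finite} ^ 'n) set"
  shows "(\<Sum>S\<in>\<S>. real (card (P - sphere_points Q S))) =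
    real (card P) * real (card \<S>) - real (incidences Q P \<S>)"
proof -
  have "{(p, S). p \<in> P \<and> S \<in> \<S> \<and> p \<in> sphere_points Q S} =
      (\<lambda>(S, p). (p, S)) ` (SIGMA S:\<S>. P \<inter> sphere_points Q S)"
    by auto
  then have "incidences Q P \<S> = card (SIGMA S:\<S>. P \<inter> sphere_points Q S)"
    unfolding incidences_def by (simp only:) (rule card_image, auto simp: inj_on_def)
  also have "\<dots> = (\<Sum>S\<in>\<S>. card (P \<inter> sphere_points Q S))"
    by simp
  finally have "real (incidences Q P \<S>) = (\<Sum>S\<in>\<S>. real (card (P \<inter> sphere_points Q S)))"
    by simp
  moreover have "real (card P) = real (card (P - sphere_points Q S)) + real (card (P \<inter> sphere_points Q S))"
    for S
    using card_Diff_subset_Int[of P "sphere_points Q S"] card_mono[of P "P \<inter> sphere_points Q S"]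
    by simp
  then have "real (card P) * real (card \<S>) =
    (\<Sum>S\<in>\<S>. real (card (P - sphere_points Q S)) + real (card (P \<inter> sphere_points Q S)))"
    by (simp flip: of_nat_add)
  ultimately show ?thesis
    by (simp add: sum.distrib)
qed

section \<open>Existence of a classifying flat\<close>

lemma (in odd_quadratic_form) classifying_flat_exists:
  fixes P :: "('a ^ 'n) set" and \<S> :: "('a, 'n) qsphere set" and \<delta> :: real
  assumes "P \<noteq> {}" "\<S> \<noteq> {}" "0 \<le> \<delta>" "\<delta> * (real CARD('n) + 2) < real CARD('n) + 1"
    and missed: "(\<Sum>S\<in>\<S>. real (card (P - sphere_points Q S))) \<le>
      \<delta> * (\<delta> / (real CARD('n) + 1) * real (card P)) * real (card \<S>)"
  shows "\<exists>L P0 \<S>0. classifies Q P \<S> \<delta> L P0 \<S>0"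
proof -
  define d where "d = real CARD('n)"
  have d: "d \<ge> 0" by (simp add: d_def)
  have P: "card P > 0" and \<S>: "card \<S> > 0"
    using assms by (auto simp: card_gt_0_iff)
  \<comment> \<open>The threshold is chosen so that \<open>d + 1\<close> spheres, each missing at
    most \<open>t\<close> points, together miss at most a \<open>\<delta>\<close>-fraction of
    \<open>P\<close>.\<close>
  define t where "t = \<delta> / (d + 1) * real (card P)"
  define m where "m S = real (card (P - sphere_points Q S))" for S
  define G where "G = {S \<in> \<S>. m S \<le> t}"
  have t: "t \<ge> 0" "\<delta> = 0 \<or> t > 0"
    using assms(3) d P by (auto simp: t_def intro!: divide_pos_pos)
  have "real (card {S \<in> \<S>. t < m S}) \<le> \<delta> * real (card \<S>)"
    by (rule card_Markov) (use t missed assms(3) in \<open>auto simp: m_def t_def d_def\<close>)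
  moreover have "{S \<in> \<S>. t < m S} = \<S> - G"
    by (auto simp: G_def)
  moreover have "real (card (\<S> - G)) = real (card \<S>) - real (card G)"
    using card_mono[of \<S> G] by (simp add: G_def card_Diff_subset of_nat_diff)
  ultimately have G: "real (card G) \<ge> (1 - \<delta>) * real (card \<S>)"
    by (simp add: algebra_simps)
  have "\<delta> * (d + 2) < d + 1" using assms(4) by (simp add: d_def)
  then have "\<delta> < 1"
    using d assms(3) by (smt (verit) mult_le_cancel_right1)
  then have "real (card G) > 0"
    using G \<S> by (smt (verit) mult_pos_pos of_nat_0_less_iff)
  then have "sphere_lift Q ` G \<noteq> {}" by auto
  then obtain p B where B: "p \<in> sphere_lift Q ` G" "lifted.p.independent B"
    "(\<lambda>b. p + b) ` B \<subseteq> sphere_lift Q ` G" "sphere_lift Q ` G \<subseteq> (\<lambda>w. p + w) ` lifted.p.span B"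
    by (rule lifted.p.flat_hull)
  define L where "L = (\<lambda>w. p + w) ` lifted.p.span B"
  define F where "F = insert p ((\<lambda>b. p + b) ` B)"
  have finB: "finite B" by (rule finite)
  have "card F \<le> Suc (card B)"
    using card_image_le[OF finB, of "\<lambda>b. p + b"] finB by (simp add: F_def card_insert_if)
  have F: "F \<subseteq> sphere_lift Q ` G"
    using B by (auto simp: F_def)
  \<comment> \<open>A point incident with all generators in \<open>F\<close> is incident with their
    whole affine span, so a point outside the base set fails at some generator.\<close>
  have P_diff: "P - base_points Q L \<subseteq> (\<Union>y\<in>F. {x \<in> P. \<phi> x y \<noteq> Q x})"
    using mem_base_points_translate_span unfolding L_def F_def by fastforce
  have "real (card {x \<in> P. \<phi> x y \<noteq> Q x}) \<le> t" if "y \<in> F" for y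
  proof -
    obtain S where S: "S \<in> G" "y = sphere_lift Q S"
      using F \<open>y \<in> F\<close> by blast
    have "{x \<in> P. \<phi> x y \<noteq> Q x} = P - sphere_points Q S"
      by (auto simp: S mem_sphere_points)
    then show ?thesis
      using S by (simp add: G_def m_def)
  qed
  then have sum: "(\<Sum>y\<in>F. real (card {x \<in> P. \<phi> x y \<noteq> Q x})) \<le> real (card F) * t"
    by (rule sum_bounded_above)
  have "real (card (P - base_points Q L)) \<le> real (card (\<Union>y\<in>F. {x \<in> P. \<phi> x y \<noteq> Q x}))"
    using P_diff by (simp add: card_mono)
  also have "\<dots> \<le> (\<Sum>y\<in>F. real (card {x \<in> P. \<phi> x y \<noteq> Q x}))"
    using card_UN_le[of F "\<lambda>y. {x \<in> P. \<phi> x y \<noteq> Q x}"] by (simp flip: of_nat_sum)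
  also have "\<dots> \<le> (real (card B) + 1) * t"
  proof -
    have "real (card F) \<le> real (card B) + 1"
      using \<open>card F \<le> Suc (card B)\<close> by linarith
    then show ?thesis
      using sum t(1) by (meson mult_right_mono order_trans)
  qed
  finally have lost: "real (card (P - base_points Q L)) \<le> (real (card B) + 1) * t" .
  have dim: "lifted.p.dim (UNIV :: (('a ^ 'n) \<times> 'a) set) = CARD('n) + 1"
    using lifted.dim_Times[OF vec.subspace_UNIV vector_space_over_itself.subspace_UNIV]
    by (simp add: card_cart_basis)
  have "card B \<le> CARD('n) + 1"
    using lifted.p.independent_card_le_dim[of B UNIV] B(2) dim by simp
  \<comment> \<open>With \<open>d + 1\<close> independent directions \<open>L\<close> is the whole
    space and has no base points, so all of \<open>P\<close> is lost; but \<open>d + 2\<close>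
    generators account for at most \<open>(d + 2) * t < card P\<close> points.\<close>
  moreover have "card B \<noteq> CARD('n) + 1"
  proof
    assume cardB: "card B = CARD('n) + 1"
    then have "lifted.p.span B = UNIV"
      using lifted.p.card_eq_dim[of B UNIV] B(2) dim finB by auto
    then have "L = UNIV"
      by (simp add: L_def)
    then have "real (card P) \<le> (d + 2) * t"
      using lost cardB by (simp add: base_points_UNIV d_def algebra_simps)
    also have "\<dots> = (\<delta> * (d + 2)) / (d + 1) * real (card P)"
      by (simp add: t_def)
    finally show False
      using P d \<open>\<delta> * (d + 2) < d + 1\<close> by (simp add: le_divide_eq mult_le_cancel_right)
  qed
  \<comment> \<open>At most \<open>d\<close> directions remain; with the base point \<open>p\<close>
    this makes at most \<open>d + 1\<close> generators, matching the denominator of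
    \<open>t\<close>.\<close>
  ultimately have "real (card B) + 1 \<le> d + 1"
    by (simp add: d_def)
  then have "(real (card B) + 1) * t \<le> (d + 1) * t"
    using t(1) by (rule mult_right_mono)
  also have "\<dots> = \<delta> * real (card P)"
    using d by (simp add: t_def)
  finally have "real (card (P - base_points Q L)) \<le> \<delta> * real (card P)"
    using lost by linarith
  moreover have "real (card (P - base_points Q L)) = real (card P) - real (card (P \<inter> base_points Q L))"
    by (simp add: card_Diff_subset_Int card_mono of_nat_diff)
  moreover have "flat lifted.scale L"
    unfolding flat_def L_def using lifted.p.subspace_span by blast
  moreover have "G \<subseteq> \<S> \<inter> spheres_of Q L"
    using B(4) by (auto simp: L_def spheres_of_def G_def)
  ultimately have "classifies Q P \<S> \<delta> L (P \<inter> base_points Q L) G"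
    using G by (simp add: classifies_def left_diff_distrib)
  then show ?thesis by blast
qed

section \<open>The dimension bound and the coaxal pencil\<close>

theorem corollary2p12:
  fixes Q :: "'a::{field, finite} ^ 'n \<Rightarrow> 'a"
    and P :: "('a ^ 'n) set"
    and \<S> :: "('a, 'n) qsphere set"
    and \<mu> \<delta> \<gamma> :: real
  assumes "odd CARD('a)"
    and "CARD('n) \<ge> 2"
    and "quadratic_form Q"
    and "nondegenerate Q"
    and "P \<noteq> {}"
    and "\<S> \<noteq> {}"
    and "\<mu> = 1 - real (incidences Q P \<S>) / (real (card P) * real (card \<S>))"
    and "0 \<le> \<mu>"
    and "\<mu> < (real CARD('n) + 1) / (real CARD('n) + 2)\<^sup>2"
    and "\<delta> = sqrt ((real CARD('n) + 1) * \<mu>)"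
    and "\<gamma> > \<delta>"
    and "\<And>V. flat (*s) V \<Longrightarrow> flat_dim (*s) V + 2 = CARD('n) \<Longrightarrow>
           real (card (P \<inter> V)) \<le> (1 - \<gamma>) * real (card P)"
  shows "(\<exists>L P0 \<S>0. classifies Q P \<S> \<delta> L P0 \<S>0) \<and>
    (\<forall>L P0 \<S>0. classifies Q P \<S> \<delta> L P0 \<S>0 \<longrightarrow> flat_dim lifted.scale L \<le> 1) \<and>
    ((1 - \<delta>) * real (card \<S>) \<ge> 2 \<longrightarrow>
      (\<forall>L P0 \<S>0. classifies Q P \<S> \<delta> L P0 \<S>0 \<longrightarrow>
         flat_dim lifted.scale L = 1 \<and>
         real (card (P - P0)) \<le> \<delta> * real (card P) \<and>
         real (card (\<S> - \<S>0)) \<le> \<delta> * real (card \<S>) \<and>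
         coaxal_pencil Q (spheres_of Q L) \<and>
         \<S>0 \<subseteq> spheres_of Q L \<and>
         P0 \<subseteq> base_points Q L \<and>
         (\<forall>S\<in>spheres_of Q L. \<forall>S'\<in>spheres_of Q L. S \<noteq> S' \<longrightarrow>
            base_points Q L = sphere_points Q S \<inter> sphere_points Q S')))"
proof -
  interpret odd_quadratic_form Q
    by unfold_locales (use assms two_neq_zero_if_odd_card in auto)
  define d where "d = real CARD('n)"
  have d: "d \<ge> 0" by (simp add: d_def)
  have P: "real (card P) > 0" and \<S>: "real (card \<S>) > 0"
    using assms by (auto simp: card_gt_0_iff)
  have \<delta>0: "\<delta> \<ge> 0" and \<delta>sq: "\<delta>\<^sup>2 = (d + 1) * \<mu>"
    using assms(8,10) d by (simp_all add: d_def)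
  have "\<delta>\<^sup>2 * (d + 2)\<^sup>2 < (d + 1)\<^sup>2"
  proof -
    have "\<mu> * (d + 2)\<^sup>2 < d + 1"
      using assms(9) d by (simp add: d_def pos_less_divide_eq)
    then have "(d + 1) * (\<mu> * (d + 2)\<^sup>2) < (d + 1) * (d + 1)"
      using d by (intro mult_strict_left_mono) auto
    then show ?thesis
      by (simp only: \<delta>sq) (simp add: power2_eq_square mult_ac)
  qed
  \<comment> \<open>Both sides of the inequality are squares of nonnegative numbers, so the bound on
    \<open>\<mu>\<close> becomes the linear bound that excludes the whole space.\<close>
  then have \<delta>_less: "\<delta> * (d + 2) < d + 1"
    using d by (simp flip: power_mult_distrib) (rule power2_less_imp_less, auto)
  then have \<delta>1: "\<delta> < 1"
    using d \<delta>0 by (smt (verit) mult_le_cancel_right1)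
  have "real (incidences Q P \<S>) = (1 - \<mu>) * (real (card P) * real (card \<S>))"
    using assms(5,6) by (simp add: assms(7) field_simps)
  then have "(\<Sum>S\<in>\<S>. real (card (P - sphere_points Q S))) = \<mu> * real (card P) * real (card \<S>)"
    by (simp add: sum_card_missed_points algebra_simps)
  \<comment> \<open>One factor \<open>\<delta>\<close> is the fraction of spheres to discard; the
    other enters the threshold on missed points.\<close>
  also have "\<dots> = \<delta> * (\<delta> / (d + 1) * real (card P)) * real (card \<S>)"
      proof -
    have "\<mu> = \<delta> * (\<delta> / (d + 1))"
      using d \<delta>sq by (simp add: power2_eq_square)
    then show ?thesis by (simp add: mult.assoc)
  qed
  finally have exists: "\<exists>L P0 \<S>0. classifies Q P \<S> \<delta> L P0 \<S>0"
    using assms(5,6) \<delta>0 \<delta>_less by (intro classifying_flat_exists) (auto simp: d_def)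
  have dim: "flat_dim lifted.scale L \<le> 1" if c: "classifies Q P \<S> \<delta> L P0 \<S>0" for L P0 \<S>0
  proof (rule ccontr)
    assume "\<not> flat_dim lifted.scale L \<le> 1"
    then have gt: "flat_dim lifted.scale L > 1" by simp
    have P0: "P0 \<subseteq> P \<inter> base_points Q L" "real (card P0) \<ge> (1 - \<delta>) * real (card P)"
      and L: "flat lifted.scale L"
      using c by (auto simp: classifies_def)
    have "real (card P0) > 0"
      using P0(2) \<delta>1 P by (smt (verit) mult_pos_pos)
    then have "base_points Q L \<noteq> {}"
      using P0(1) by auto
    then obtain V where V: "flat (*s) V" "flat_dim (*s) V + 2 = CARD('n)" "base_points Q L \<subseteq> V"
      using base_points_in_codim_two_flat assms(4) L gt by blast
    \<comment> \<open>\<open>P0\<close> lies in \<open>V\<close>, so \<open>V\<close> carries at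
      least a \<open>(1 - \<delta>)\<close>-fraction of \<open>P\<close>, more than
      \<open>\<gamma> > \<delta>\<close> allows.\<close>
    have "(1 - \<delta>) * real (card P) \<le> real (card (P \<inter> V))"
      using P0 V(3) card_mono[of "P \<inter> V" P0] by fastforce
    also have "\<dots> \<le> (1 - \<gamma>) * real (card P)"
      using assms(12) V by blast
    finally show False
      using assms(11) P by simp
  qed
  have main: "flat_dim lifted.scale L = 1 \<and>
         real (card (P - P0)) \<le> \<delta> * real (card P) \<and>
         real (card (\<S> - \<S>0)) \<le> \<delta> * real (card \<S>) \<and>
         coaxal_pencil Q (spheres_of Q L) \<and>
         \<S>0 \<subseteq> spheres_of Q L \<and>
         P0 \<subseteq> base_points Q L \<and>
         (\<forall>S\<in>spheres_of Q L. \<forall>S'\<in>spheres_of Q L. S \<noteq> S' \<longrightarrow>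
            base_points Q L = sphere_points Q S \<inter> sphere_points Q S')"
    if two: "(1 - \<delta>) * real (card \<S>) \<ge> 2" and c: "classifies Q P \<S> \<delta> L P0 \<S>0" for L P0 \<S>0
  proof -
    have L: "flat lifted.scale L" and P0: "P0 \<subseteq> P \<inter> base_points Q L"
      and S0: "\<S>0 \<subseteq> \<S> \<inter> spheres_of Q L"
      and cards: "real (card P0) \<ge> (1 - \<delta>) * real (card P)"
        "real (card \<S>0) \<ge> (1 - \<delta>) * real (card \<S>)"
      using c by (auto simp: classifies_def)
    \<comment> \<open>Spheres with distinct parameters have distinct lifts, so any two members of
      the family determine the line \<open>L\<close>.\<close>
    have line: "L = line_through lifted.scale (sphere_lift Q S) (sphere_lift Q S') \<and>
        flat_dim lifted.scale L = 1"
      if "S \<in> spheres_of Q L" "S' \<in> spheres_of Q L" "S \<noteq> S'" for S S'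
    proof -
      have "sphere_lift Q S \<noteq> sphere_lift Q S'"
        using \<open>S \<noteq> S'\<close> bij_sphere_lift by (metis bij_is_inj injD)
      then show ?thesis
        using lifted.p.flat_dim_le_1_eq_line[OF L dim[OF c]] that(1,2)
        by (metis spheres_of_def vimageD)
    qed
    have pair: "base_points Q L = sphere_points Q S \<inter> sphere_points Q S'"
      if "S \<in> spheres_of Q L" "S' \<in> spheres_of Q L" "S \<noteq> S'" for S S'
      using line[OF that] base_points_line by blast
    have "card \<S>0 \<ge> 2"
      using two cards by linarith
    then obtain S S' where S: "S \<in> \<S>0" "S' \<in> \<S>0" "S \<noteq> S'"
      by (metis card_le_Suc0_iff_eq finite not_less_eq_eq numeral_2_eq_2)
    then have SS: "L = line_through lifted.scale (sphere_lift Q S) (sphere_lift Q S')"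
      "flat_dim lifted.scale L = 1"
      using line S0 by blast+
    \<comment> \<open>Surjectivity of the lift ensures that the family fills the entire line, as a
      coaxal pencil requires.\<close>
    have "sphere_lift Q ` spheres_of Q L = L"
      using bij_sphere_lift by (simp add: spheres_of_def bij_def surj_image_vimage_eq)
    then have "coaxal_pencil Q (spheres_of Q L)"
      unfolding coaxal_pencil_def using S(3) SS(1) by (intro exI[of _ S] exI[of _ S'] conjI) simp_all
    moreover have "real (card (P - P0)) = real (card P) - real (card P0)"
      using P0 by (simp add: card_Diff_subset card_mono of_nat_diff)
    moreover have "real (card (\<S> - \<S>0)) = real (card \<S>) - real (card \<S>0)"
      using S0 by (simp add: card_Diff_subset card_mono of_nat_diff)
    ultimately show ?thesis
      using SS(2) cards P0 S0 pair
      by (intro conjI ballI impI) (simp_all add: left_diff_distrib)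
  qed
  show ?thesis
    by (rule conjI[OF exists conjI]; (rule allI impI)+; (rule dim main; assumption))
qed

end
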